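(* Let $p\in(1,+\infty)$, let $K\subset\mathbb{R}^d$ be a compact set and let $$\mathcal{Q}_K:=\big\{\mu\in\mathcal{P}_p(\mathbb{R}^d):\ \mathrm{supp}(\mu)\subset K\big\}.$$ Then for every $\mu\in\mathcal{Q}_K$, it holds that $$\Big\{\xi\in\mathcal{L}^p(\mathbb{R}^d,\mathbb{R}^d;\mu):\ \xi(x)\in T^\flat_K(x)\ \text{for $\mu$-almost every } x\in K\Big\}\subset T^\flat_{\mathcal{Q}_K}(\mu),$$ where $T^\flat_K(x)$ is the standard adjacent cone to $K$ at $x\in K$ and $T^\flat_{\mathcal{Q}_K}(\mu)$ is the adjacent cone to $\mathcal{Q}_K$ at $\mu$.
   Context: $\mathcal{P}_p(\mathbb{R}^d)$ is the set of Borel probability measures on $\mathbb{R}^d$ with finite $p$-th moment, endowed with the Wasserstein distance $W_p$ of order $p$; $f_\sharp\mu$ is the image measure; $\mathrm{supp}(\mu)$ is the support of $\mu$. $\mathcal{L}^p(\mathbb{R}^d,\mathbb{R}^d;\mu)$ is the seminormed space of Borel maps $\mathbb{R}^d\to\mathbb{R}^d$ that are $p$-integrable with respect to $\mu$. The adjacent cone to $\mathcal{Q}_K$ at $\mu\in\mathcal{Q}_K$ is $$T^\flat_{\mathcal{Q}_K}(\mu):=\Big\{\xi\in\mathcal{L}^p(\mathbb{R}^d,\mathbb{R}^d;\mu):\ \lim_{h\to0^+}\tfrac1h\,\mathrm{dist}_{\mathcal{P}_p(\mathbb{R}^d)}\big((\mathrm{Id}+h\xi)_\sharp\mu;\mathcal{Q}_K\big)=0\Big\},$$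 with $\mathrm{dist}_{\mathcal{P}_p(\mathbb{R}^d)}(\sigma;\mathcal{Q}_K)=\inf_{\sigma'\in\mathcal{Q}_K}W_p(\sigma,\sigma')$. The standard adjacent cone to $K$ at $x\in K$ is $T^\flat_K(x)=\{v\in\mathbb{R}^d:\lim_{h\to0^+}\frac1h\,\mathrm{dist}_{\mathbb{R}^d}(x+hv;K)=0\}$. *)

theory Defs
  imports "HOL-Probability.Probability"
begin

definition wasserstein_space :: "real \<Rightarrow> (real ^ 'd) measure set" where
  "wasserstein_space p =
     {\<mu>. prob_space \<mu> \<and> sets \<mu> = sets borel \<and> integrable \<mu> (\<lambda>x. norm x powr p)}"

definition measure_support :: "'a::topological_space measure \<Rightarrow> 'a set" where
  "measure_support \<mu> = {x. \<forall>U. open U \<longrightarrow> x \<in> U \<longrightarrow> emeasure \<mu> U > 0}"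

definition couplings ::
    "(real ^ 'd) measure \<Rightarrow> (real ^ 'd) measure \<Rightarrow> ((real ^ 'd) \<times> (real ^ 'd)) measure set" where
  "couplings \<mu> \<nu> =
     {\<pi>. prob_space \<pi> \<and> sets \<pi> = sets (borel \<Otimes>\<^sub>M borel) \<and>
          distr \<pi> borel fst = \<mu> \<and> distr \<pi> borel snd = \<nu>}"

text \<open>
  The optimal transport cost is an infimum in \<^typ>\<open>ennreal\<close>. It is finite for measures in
  \<^const>\<open>wasserstein_space\<close>, so the conversion to \<^typ>\<open>real\<close> loses nothing there.
\<close>

definition wasserstein_dist :: "real \<Rightarrow> (real ^ 'd) measure \<Rightarrow> (real ^ 'd) measure \<Rightarrow> real" where
  "wasserstein_dist p \<mu> \<nu> =
     enn2real (INF \<pi>\<in>couplings \<mu> \<nu>. \<integral>\<^sup>+ z. ennreal (dist (fst z) (snd z) powr p) \<partial>\<pi>)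
       powr (1 / p)"

definition wasserstein_infdist ::
    "real \<Rightarrow> (real ^ 'd) measure \<Rightarrow> (real ^ 'd) measure set \<Rightarrow> real" where
  "wasserstein_infdist p \<sigma> Q = (INF \<sigma>'\<in>Q. wasserstein_dist p \<sigma> \<sigma>')"

text \<open>Maps, not equivalence classes modulo almost-everywhere equality.\<close>

definition Lp_maps :: "real \<Rightarrow> (real ^ 'd) measure \<Rightarrow> (real ^ 'd \<Rightarrow> real ^ 'd) set" where
  "Lp_maps p \<mu> = {\<xi> \<in> borel_measurable borel. integrable \<mu> (\<lambda>x. norm (\<xi> x) powr p)}"

text \<open>
  Both cones are meant at points of the set only: \<^term>\<open>x \<in> K\<close>, respectively \<^term>\<open>\<mu> \<in> Q\<close> with
  \<^term>\<open>Q \<subseteq> wasserstein_space p\<close>. In particular the infima below are then over nonempty sets.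
\<close>

definition adjacent_cone :: "(real ^ 'd) set \<Rightarrow> real ^ 'd \<Rightarrow> (real ^ 'd) set" where
  "adjacent_cone K x = {v. ((\<lambda>h. 1 / h * infdist (x + h *\<^sub>R v) K) \<longlongrightarrow> 0) (at_right 0)}"

definition wasserstein_adjacent_cone ::
    "real \<Rightarrow> (real ^ 'd) measure set \<Rightarrow> (real ^ 'd) measure \<Rightarrow> (real ^ 'd \<Rightarrow> real ^ 'd) set" where
  "wasserstein_adjacent_cone p Q \<mu> =
     {\<xi> \<in> Lp_maps p \<mu>.
        ((\<lambda>h. 1 / h * wasserstein_infdist p (distr \<mu> borel (\<lambda>x. x + h *\<^sub>R \<xi> x)) Q) \<longlongrightarrow> 0)
          (at_right 0)}"

definition measures_supported_in :: "real \<Rightarrow> (real ^ 'd) set \<Rightarrow> (real ^ 'd) measure set" where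
  "measures_supported_in p K = {\<mu> \<in> wasserstein_space p. measure_support \<mu> \<subseteq> K}"

end

theory Submission
  imports Defs
begin

text \<open>
  Push \<open>\<mu>\<close> forward by \<open>x \<mapsto> x + h \<xi>(x)\<close> and then move each image point back to a nearly
  nearest point of \<open>K\<close>. The result is a measure supported in \<open>K\<close>, and the joint law of the two
  points is a coupling, so the distance to the measures supported in \<open>K\<close> is at most the \<open>L\<^sup>p(\<mu>)\<close>
  norm of \<open>x \<mapsto> dist(x + h \<xi>(x), K)\<close>, up to an arbitrarily small slack
  (\<open>wasserstein_infdist_le\<close>). With slack \<open>h\<^sup>2\<close>, division by \<open>h\<close> leaves the \<open>L\<^sup>p(\<mu>)\<close> norm of
  \<open>dist(x + h \<xi>(x), K) / h + h\<close>. This tends to \<open>0\<close> almost everywhere because \<open>\<xi>(x)\<close> is adjacent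
  to \<open>K\<close>, and it is at most \<open>norm (\<xi> x) + 1\<close> for \<open>x \<in> K\<close> and \<open>h < 1\<close>, as \<open>x\<close> itself is then a
  competitor for the distance. Dominated convergence concludes.

  Working with nearly nearest points rather than nearest ones keeps the selection elementary: it can
  be made with countably many values.
\<close>

section \<open>Measurable near-projections\<close>

lemma borel_measurable_infdist [measurable (raw)]:
  fixes f :: "'a \<Rightarrow> 'b::metric_space"
  assumes "f \<in> borel_measurable M"
  shows "(\<lambda>x. infdist (f x) K) \<in> borel_measurable M"
  using assms by (rule borel_measurable_continuous_on[rotated]) (intro continuous_intros)

text \<open>
  Enumerate a countable dense subset of \<open>K\<close> and send each point to the first element of the
  enumeration that is close enough to it.
\<close>

lemma measurable_near_projection:
  fixes K :: "'a::{metric_space, second_countable_topology} set"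
  assumes "K \<noteq> {}" and "0 < \<epsilon>"
  obtains f where "f \<in> borel_measurable borel"
    and "\<And>x. f x \<in> K" and "\<And>x. dist x (f x) \<le> infdist x K + \<epsilon>"
proof -
  obtain D where D: "countable D" "D \<subseteq> K" "K \<subseteq> closure D"
    by (rule separable)
  with assms have "D \<noteq> {}" by auto
  define q where "q = from_nat_into D"
  have range_q: "range q = D"
    unfolding q_def using D \<open>D \<noteq> {}\<close> by (simp add: range_from_nat_into)
  define near where "near n x \<longleftrightarrow> dist x (q n) < infdist x K + \<epsilon>" for n x
  have ex_near: "\<exists>n. near n x" for x
  proof -
    have "infdist x K < infdist x K + \<epsilon> / 2" using assms by simp
    then obtain a where a: "a \<in> K" "dist x a < infdist x K + \<epsilon> / 2"
      unfolding infdist_notempty[OF \<open>K \<noteq> {}\<close>]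
      by (subst (asm) cINF_less_iff) (auto simp: \<open>K \<noteq> {}\<close>)
    with D have "a \<in> closure D" by auto
    then obtain d where "d \<in> D" "dist d a < \<epsilon> / 2"
      using assms unfolding closure_approachable by (meson half_gt_zero)
    moreover have "dist x d \<le> dist x a + dist d a"
      by (metis dist_commute dist_triangle)
    ultimately show ?thesis
      using a range_q unfolding near_def by (smt (verit) field_sum_of_halves imageE)
  qed
  define f where "f x = q (LEAST n. near n x)" for x
  have "(\<lambda>x. LEAST n. near n x) \<in> measurable borel (count_space UNIV)"
    unfolding near_def by measurable
  then have "f \<in> borel_measurable borel"
    unfolding f_def by (rule measurable_compose) simp
  moreover have "f x \<in> K" for x
    using range_q D unfolding f_def by auto
  moreover have "near (LEAST n. near n x) x" for x
    using ex_near by (rule LeastI_ex)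
  then have "dist x (f x) \<le> infdist x K + \<epsilon>" for x
    unfolding near_def f_def by (simp add: less_imp_le)
  ultimately show thesis using that by blast
qed

section \<open>Measures supported in a closed set\<close>

text \<open>
  Points outside the support have null neighbourhoods, and by the Lindelof property countably many of
  these cover the complement of the support.
\<close>

lemma AE_in_closed_superset_of_support:
  fixes \<mu> :: "'a::second_countable_topology measure"
  assumes "sets \<mu> = sets borel" and "closed K" and "measure_support \<mu> \<subseteq> K"
  shows "AE x in \<mu>. x \<in> K"
proof -
  define \<U> where "\<U> = {U. open U \<and> emeasure \<mu> U = 0}"
  have "- K \<subseteq> \<Union>\<U>"
    using assms(3) unfolding measure_support_def \<U>_def
    by (auto simp: subset_iff not_less zero_less_iff_neq_zero)
  moreover obtain \<V> where \<V>: "\<V> \<subseteq> \<U>" "countable \<V>" "\<Union>\<V> = \<Union>\<U>"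
    using Lindelof[of \<U>] unfolding \<U>_def by blast
  moreover have "(\<Union>U\<in>\<V>. U) \<in> null_sets \<mu>"
    using \<V> assms(1) by (intro null_sets_UN') (auto simp: \<U>_def null_sets_def)
  ultimately show ?thesis
    by (intro AE_I'[of "\<Union>\<V>"]) auto
qed

lemma measures_supported_in_compactI:
  assumes "0 \<le> p" and "prob_space \<nu>" and sets: "sets \<nu> = sets borel"
    and "compact K" and AE: "AE x in \<nu>. x \<in> K"
  shows "\<nu> \<in> measures_supported_in p K"
proof -
  interpret prob_space \<nu> by fact
  obtain B where B: "\<And>x. x \<in> K \<Longrightarrow> norm x \<le> B"
    using \<open>compact K\<close> compact_imp_bounded bounded_iff by metis
  have "integrable \<nu> (\<lambda>x. norm x powr p)"
  proof (rule integrable_const_bound)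
    show "AE x in \<nu>. norm (norm x powr p) \<le> B powr p"
      using AE by eventually_elim (use B \<open>0 \<le> p\<close> in \<open>auto intro: powr_mono2\<close>)
    show "(\<lambda>x. norm x powr p) \<in> borel_measurable \<nu>"
      using sets by (simp cong: measurable_cong_sets)
  qed
  moreover have "measure_support \<nu> \<subseteq> K"
  proof
    fix x assume x: "x \<in> measure_support \<nu>"
    have "open (- K)" using \<open>compact K\<close> compact_imp_closed by auto
    moreover have "emeasure \<nu> (- K) = 0"
    proof -
      have "- K = {x \<in> space \<nu>. x \<notin> K}"
        using sets_eq_imp_space_eq[OF sets] by auto
      then show ?thesis
        using AE \<open>open (- K)\<close> sets by (metis AE_iff_measurable borel_open)
    qed
    ultimately show "x \<in> K"
      using x unfolding measure_support_def by force
  qed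
  ultimately show ?thesis
    using sets prob_space_axioms
    unfolding measures_supported_in_def wasserstein_space_def by auto
qed

section \<open>Bounds on the Wasserstein distance\<close>

text \<open>The joint law of \<open>f\<close> and \<open>g\<close> is a coupling.\<close>

lemma wasserstein_dist_distr_le:
  fixes f g :: "'a \<Rightarrow> real ^ 'd"
  assumes "prob_space \<mu>" and "0 < p"
    and f[measurable]: "f \<in> borel_measurable \<mu>" and g[measurable]: "g \<in> borel_measurable \<mu>"
    and int: "integrable \<mu> (\<lambda>x. dist (f x) (g x) powr p)"
  shows "wasserstein_dist p (distr \<mu> borel f) (distr \<mu> borel g)
           \<le> (\<integral>x. dist (f x) (g x) powr p \<partial>\<mu>) powr (1 / p)"
proof -
  define \<pi> where "\<pi> = distr \<mu> (borel \<Otimes>\<^sub>M borel) (\<lambda>x. (f x, g x))"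
  have "\<pi> \<in> couplings (distr \<mu> borel f) (distr \<mu> borel g)"
    using assms(1) unfolding couplings_def \<pi>_def
    by (auto simp: distr_distr comp_def intro!: prob_space.prob_space_distr)
  moreover have "(\<integral>\<^sup>+ z. ennreal (dist (fst z) (snd z) powr p) \<partial>\<pi>)
      = (\<integral>\<^sup>+ x. ennreal (dist (f x) (g x) powr p) \<partial>\<mu>)"
    unfolding \<pi>_def by (subst nn_integral_distr) auto
  moreover have "\<dots> = ennreal (\<integral>x. dist (f x) (g x) powr p \<partial>\<mu>)"
    using int by (intro nn_integral_eq_integral) auto
  ultimately have "(INF \<pi>\<in>couplings (distr \<mu> borel f) (distr \<mu> borel g).
        \<integral>\<^sup>+ z. ennreal (dist (fst z) (snd z) powr p) \<partial>\<pi>)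
      \<le> ennreal (\<integral>x. dist (f x) (g x) powr p \<partial>\<mu>)"
    by (metis (no_types, lifting) INF_lower)
  then have "enn2real (INF \<pi>\<in>couplings (distr \<mu> borel f) (distr \<mu> borel g).
        \<integral>\<^sup>+ z. ennreal (dist (fst z) (snd z) powr p) \<partial>\<pi>)
      \<le> (\<integral>x. dist (f x) (g x) powr p \<partial>\<mu>)"
    by (intro enn2real_leI) auto
  then show ?thesis
    unfolding wasserstein_dist_def using \<open>0 < p\<close> by (intro powr_mono2) auto
qed

lemma wasserstein_infdist_nonneg:
  assumes "Q \<noteq> {}"
  shows "0 \<le> wasserstein_infdist p \<sigma> Q"
  unfolding wasserstein_infdist_def
  using assms by (intro cINF_greatest) (auto simp: wasserstein_dist_def)

text \<open>The competitor is the law of a near-projection of \<open>f\<close> onto \<open>K\<close>.\<close>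

lemma wasserstein_infdist_le:
  fixes f :: "'a \<Rightarrow> real ^ 'd"
  assumes "prob_space \<mu>" and "0 < p" and "compact K" and "K \<noteq> {}" and "0 < \<epsilon>"
    and f[measurable]: "f \<in> borel_measurable \<mu>"
    and int: "integrable \<mu> (\<lambda>x. (infdist (f x) K + \<epsilon>) powr p)"
  shows "wasserstein_infdist p (distr \<mu> borel f) (measures_supported_in p K)
           \<le> (\<integral>x. (infdist (f x) K + \<epsilon>) powr p \<partial>\<mu>) powr (1 / p)"
proof -
  interpret prob_space \<mu> by fact
  obtain P where P[measurable]: "P \<in> borel_measurable borel"
    and P_in: "\<And>x. P x \<in> K" and P_near: "\<And>x. dist x (P x) \<le> infdist x K + \<epsilon>"
    using measurable_near_projection[OF \<open>K \<noteq> {}\<close> \<open>0 < \<epsilon>\<close>] by blast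
  let ?g = "\<lambda>x. P (f x)"
  have le: "dist (f x) (?g x) powr p \<le> (infdist (f x) K + \<epsilon>) powr p" for x
    using P_near[of "f x"] \<open>0 < p\<close> by (intro powr_mono2) auto
  have int': "integrable \<mu> (\<lambda>x. dist (f x) (?g x) powr p)"
    using int by (rule Bochner_Integration.integrable_bound) (use le in \<open>auto\<close>)
  have "distr \<mu> borel ?g \<in> measures_supported_in p K"
  proof (rule measures_supported_in_compactI)
    have "K \<in> sets borel" using \<open>compact K\<close> by (simp add: borel_compact)
    then show "AE x in distr \<mu> borel ?g. x \<in> K"
      using P_in by (subst AE_distr_iff) auto
  qed (use assms in \<open>auto intro: prob_space_distr\<close>)
  then have "wasserstein_infdist p (distr \<mu> borel f) (measures_supported_in p K)
      \<le> wasserstein_dist p (distr \<mu> borel f) (distr \<mu> borel ?g)"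
    unfolding wasserstein_infdist_def
    by (intro cINF_lower bdd_belowI[where m = 0]) (auto simp: wasserstein_dist_def)
  also have "\<dots> \<le> (\<integral>x. dist (f x) (?g x) powr p \<partial>\<mu>) powr (1 / p)"
    using int' assms by (intro wasserstein_dist_distr_le) auto
  also have "\<dots> \<le> (\<integral>x. (infdist (f x) K + \<epsilon>) powr p \<partial>\<mu>) powr (1 / p)"
    using \<open>0 < p\<close> by (intro powr_mono2 integral_mono int int' le) auto
  finally show ?thesis .
qed

section \<open>The adjacent cone\<close>

lemma integrable_powr_add_one:
  fixes f :: "'a \<Rightarrow> real"
  assumes "finite_measure \<mu>" and "0 < p" and "\<And>x. 0 \<le> f x"
    and [measurable]: "f \<in> borel_measurable \<mu>" and "integrable \<mu> (\<lambda>x. f x powr p)"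
  shows "integrable \<mu> (\<lambda>x. (f x + 1) powr p)"
proof (rule Bochner_Integration.integrable_bound)
  interpret finite_measure \<mu> by fact
  show "integrable \<mu> (\<lambda>x. 2 powr p * (f x powr p + 1))"
    using assms by auto
  have "(f x + 1) powr p \<le> 2 powr p * (f x powr p + 1)" for x
  proof -
    have "(f x + 1) powr p \<le> (2 * max (f x) 1) powr p"
      using assms(2) assms(3)[of x] by (intro powr_mono2) auto
    also have "\<dots> = 2 powr p * max (f x) 1 powr p"
      by (simp add: powr_mult)
    also have "max (f x) 1 powr p \<le> f x powr p + 1"
      by (auto simp: max_def)
    finally show ?thesis by simp
  qed
  then show "AE x in \<mu>. norm ((f x + 1) powr p) \<le> norm (2 powr p * (f x powr p + 1))"
    by simp
qed measurable

theorem proposition5p1: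
  fixes p :: real and K :: "(real ^ 'd) set" and \<mu> :: "(real ^ 'd) measure"
  assumes "1 < p" and "compact K" and "\<mu> \<in> measures_supported_in p K"
  shows "{\<xi> \<in> Lp_maps p \<mu>. AE x in \<mu>. x \<in> K \<longrightarrow> \<xi> x \<in> adjacent_cone K x}
         \<subseteq> wasserstein_adjacent_cone p (measures_supported_in p K) \<mu>"
proof safe
  fix \<xi> assume \<xi>: "\<xi> \<in> Lp_maps p \<mu>" and adj: "AE x in \<mu>. x \<in> K \<longrightarrow> \<xi> x \<in> adjacent_cone K x"
  let ?Q = "measures_supported_in p K"
  have "0 < p" using assms by simp
  have "prob_space \<mu>" and sets[measurable_cong]: "sets \<mu> = sets borel" and "measure_support \<mu> \<subseteq> K"
    using assms(3) unfolding measures_supported_in_def wasserstein_space_def by auto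
  interpret prob_space \<mu> by fact
  have \<xi>_meas[measurable]: "\<xi> \<in> borel_measurable borel"
    and \<xi>_int: "integrable \<mu> (\<lambda>x. norm (\<xi> x) powr p)"
    using \<xi> unfolding Lp_maps_def by auto
  have in_K: "AE x in \<mu>. x \<in> K"
    using AE_in_closed_superset_of_support sets compact_imp_closed assms(2) \<open>measure_support \<mu> \<subseteq> K\<close>
    by blast
  then have "K \<noteq> {}"
    using AE_False by auto
  define F where "F h x = infdist (x + h *\<^sub>R \<xi> x) K / h + h" for h x
  have F_meas[measurable]: "F h \<in> borel_measurable borel" for h
    unfolding F_def by measurable
  have F_nonneg: "0 \<le> F h x" if "0 < h" for h x
    unfolding F_def using that by (simp add: infdist_nonneg)
  have F_le: "F h x \<le> norm (\<xi> x) + 1" if "0 < h" "h < 1" "x \<in> K" for h x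
  proof -
    have "infdist (x + h *\<^sub>R \<xi> x) K \<le> h * norm (\<xi> x)"
      using infdist_le[OF \<open>x \<in> K\<close>, of "x + h *\<^sub>R \<xi> x"] that by (simp add: dist_norm)
    then show ?thesis
      unfolding F_def using that by (intro add_mono) (auto simp: field_simps)
  qed
  have dom: "integrable \<mu> (\<lambda>x. (norm (\<xi> x) + 1) powr p)"
    using \<open>0 < p\<close> \<xi>_int finite_measure_axioms by (intro integrable_powr_add_one) auto
  have F_dom: "AE x in \<mu>. norm (F h x powr p) \<le> (norm (\<xi> x) + 1) powr p" if "0 < h" "h < 1" for h
    using in_K F_le[OF that] F_nonneg[OF that(1)] \<open>0 < p\<close> by (auto intro!: powr_mono2)
  have F_int: "integrable \<mu> (\<lambda>x. F h x powr p)" if "0 < h" "h < 1" for h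
    using dom by (rule Bochner_Integration.integrable_bound) (use F_dom[OF that] in auto)
  have bound: "1 / h * wasserstein_infdist p (distr \<mu> borel (\<lambda>x. x + h *\<^sub>R \<xi> x)) ?Q
      \<le> (\<integral>x. F h x powr p \<partial>\<mu>) powr (1 / p)" if h: "0 < h" "h < 1" for h
  proof -
    \<comment> \<open>The slack \<open>h\<^sup>2\<close> is positive, yet still vanishes after division by \<open>h\<close>.\<close>
    have eq: "(infdist (x + h *\<^sub>R \<xi> x) K + h\<^sup>2) powr p = h powr p * F h x powr p" for x
    proof -
      have "infdist (x + h *\<^sub>R \<xi> x) K + h\<^sup>2 = h * F h x"
        using h by (simp add: F_def distrib_left power2_eq_square)
      then show ?thesis by (simp add: powr_mult)
    qed
    have "wasserstein_infdist p (distr \<mu> borel (\<lambda>x. x + h *\<^sub>R \<xi> x)) ?Q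
        \<le> (\<integral>x. (infdist (x + h *\<^sub>R \<xi> x) K + h\<^sup>2) powr p \<partial>\<mu>) powr (1 / p)"
      using \<open>0 < p\<close> \<open>compact K\<close> \<open>K \<noteq> {}\<close> h F_int[OF h] prob_space_axioms
      by (intro wasserstein_infdist_le) (auto simp: eq)
    also have "\<dots> = h * (\<integral>x. F h x powr p \<partial>\<mu>) powr (1 / p)"
      using h \<open>0 < p\<close> by (simp add: eq powr_mult powr_powr)
    finally show ?thesis using h by (simp add: field_simps)
  qed
  have F_lim: "AE x in \<mu>. (\<lambda>n. F (h n) x powr p) \<longlonglongrightarrow> 0"
    if pos: "\<And>n. 0 < h n" and lim: "h \<longlonglongrightarrow> 0" for h :: "nat \<Rightarrow> real"
    using adj in_K
  proof eventually_elim
    case (elim x)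
    have "filterlim h (at_right 0) sequentially"
      using lim pos by (intro tendsto_imp_filterlim_at_right always_eventually) auto
    moreover have "((\<lambda>h. 1 / h * infdist (x + h *\<^sub>R \<xi> x) K) \<longlongrightarrow> 0) (at_right 0)"
      using elim by (auto simp: adjacent_cone_def)
    ultimately have "(\<lambda>n. 1 / h n * infdist (x + h n *\<^sub>R \<xi> x) K) \<longlonglongrightarrow> 0"
      by (rule filterlim_compose[rotated])
    then have "(\<lambda>n. F (h n) x) \<longlonglongrightarrow> 0"
      using tendsto_add[OF _ lim] unfolding F_def by fastforce
    then show ?case
      by (rule tendsto_zero_powrI[where b = p])
        (use \<open>0 < p\<close> pos F_nonneg in \<open>auto intro: always_eventually\<close>)
  qed
  have "((\<lambda>h. 1 / h * wasserstein_infdist p (distr \<mu> borel (\<lambda>x. x + h *\<^sub>R \<xi> x)) ?Q) \<longlongrightarrow> 0)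
          (at_right 0)"
  proof (rule tendsto_at_right_sequentially[of 0 1])
    fix h :: "nat \<Rightarrow> real"
    assume h: "\<And>n. 0 < h n" "\<And>n. h n < 1" and lim: "h \<longlonglongrightarrow> 0"
    have "(\<lambda>n. \<integral>x. F (h n) x powr p \<partial>\<mu>) \<longlonglongrightarrow> (\<integral>x. 0 \<partial>\<mu>)"
      using F_lim[OF h(1) lim] dom F_dom[OF h]
      by (intro integral_dominated_convergence[where w = "\<lambda>x. (norm (\<xi> x) + 1) powr p"]) auto
    then have F_norm: "(\<lambda>n. (\<integral>x. F (h n) x powr p \<partial>\<mu>) powr (1 / p)) \<longlonglongrightarrow> 0"
      using \<open>0 < p\<close>
      by (intro tendsto_zero_powrI[where b = "1 / p"] tendsto_const always_eventually allI
          integral_nonneg_AE AE_I2) simp_all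
    have nonneg: "0 \<le> wasserstein_infdist p \<sigma> ?Q" for \<sigma>
      using assms(3) by (intro wasserstein_infdist_nonneg) auto
    show "(\<lambda>n. 1 / h n *
        wasserstein_infdist p (distr \<mu> borel (\<lambda>x. x + h n *\<^sub>R \<xi> x)) ?Q) \<longlonglongrightarrow> 0"
    proof (rule tendsto_sandwich[OF _ _ tendsto_const F_norm])
      show "\<forall>\<^sub>F n in sequentially.
          0 \<le> 1 / h n * wasserstein_infdist p (distr \<mu> borel (\<lambda>x. x + h n *\<^sub>R \<xi> x)) ?Q"
        by (intro always_eventually allI mult_nonneg_nonneg nonneg) (simp add: h(1) less_imp_le)
      show "\<forall>\<^sub>F n in sequentially.
          1 / h n * wasserstein_infdist p (distr \<mu> borel (\<lambda>x. x + h n *\<^sub>R \<xi> x)) ?Q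
            \<le> (\<integral>x. F (h n) x powr p \<partial>\<mu>) powr (1 / p)"
        by (intro always_eventually allI bound h)
    qed
  qed simp
  with \<xi> show "\<xi> \<in> wasserstein_adjacent_cone p ?Q \<mu>"
    unfolding wasserstein_adjacent_cone_def by simp
qed

end
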